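(* Let $S\subset\mathbb{N}^p$ be an affine semigroup whose cone $\mathcal{C}_S$ has extremal rays $\tau_1,\ldots,\tau_t$, minimally generated by $E\sqcup A$ with $E=\{n_1,\ldots,n_t\}$, $n_i=\mathrm{mult}_i(S)$ for $i\in\{1,\ldots,t\}$, and $A=\{n_{t+1},\ldots,n_r\}$. Then $S$ is a MED-semigroup if and only if for any $i,j\in\{t+1,\ldots,r\}$ there exists $k\in\{1,\ldots,t\}$ such that $n_i+n_j-n_k\in S$.
   Context: $\mathbb{N}$ contains $0$, and $p\ge 1$. An affine semigroup $S\subseteq\mathbb{N}^p$ is a finitely generated submonoid of $(\mathbb{N}^p,+)$ (containing $0$). $\mathcal{C}_S$ is the set of non-negative rational linear combinations of elements of $S$, intersected with $\mathbb{N}^p$; its extremal rays are the one-dimensional faces of the rational cone generated by $S$ (intersected with $\mathbb{N}^p$). The $i$-multiplicity $\mathrm{mult}_i(S)$ is the minimum non-zero element of $\tau_i\cap S$ for the componentwise partial order on $\mathbb{N}^p$. The Apery set of $S$ with respect to $m\in S$ is $\mathrm{Ap}(S,m)=\{s\in S\mid s-m\notin S\}$. With $S$ minimally generated by $E\sqcup A$ as in the claim, $S$ is a maximal embedding dimension affine semigroup (MED-semigroup) if $\bigcap_{i=1}^t\mathrm{Ap}(S,n_i)=A\sqcup\{0\}$. *)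

theory Defs
  imports "HOL-Analysis.Analysis"
begin

text \<open>
  The monoid of \<open>p\<close>-tuples of naturals is modelled as the nonnegative orthant of
  \<^typ>\<open>int ^ 'p\<close> (so \<open>p = CARD('p)\<close>, which is at least 1) so that differences such as
  \<open>s - m\<close> are those of the ambient group of integer vectors; on \<^typ>\<open>nat ^ 'p\<close> subtraction
  would truncate. The order on vectors is componentwise.
\<close>

definition nat_vecs :: "(int ^ 'p) set" where
  "nat_vecs = {x. 0 \<le> x}"

definition add_submonoid :: "(int ^ 'p) set \<Rightarrow> bool" where
  "add_submonoid M \<longleftrightarrow> 0 \<in> M \<and> (\<forall>x\<in>M. \<forall>y\<in>M. x + y \<in> M)"

definition affine_semigroup :: "(int ^ 'p) set \<Rightarrow> bool" where
  "affine_semigroup S \<longleftrightarrow> S \<subseteq> nat_vecs \<and> (\<exists>G. finite G \<and> add_submonoid hull G = S)"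

definition minimally_generates :: "(int ^ 'p) set \<Rightarrow> (int ^ 'p) set \<Rightarrow> bool" where
  "minimally_generates G S \<longleftrightarrow>
     add_submonoid hull G = S \<and> (\<forall>H. H \<subset> G \<longrightarrow> add_submonoid hull H \<noteq> S)"

definition rat_vec :: "int ^ 'p \<Rightarrow> rat ^ 'p" where
  "rat_vec x = (\<chi> i. of_int (x $ i))"

definition rat_cone :: "(int ^ 'p) set \<Rightarrow> (rat ^ 'p) set" where
  "rat_cone S = {\<Sum>s\<in>F. q s *s rat_vec s | F q. finite F \<and> F \<subseteq> S \<and> (\<forall>s\<in>F. 0 \<le> q s)}"

definition nat_points :: "(rat ^ 'p) set \<Rightarrow> (int ^ 'p) set" where
  "nat_points K = {x \<in> nat_vecs. rat_vec x \<in> K}"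

text \<open>
  The library's notions of convex cone and face are restricted to real vector spaces. For cones,
  the condition on open segments in \<^const>\<open>face_of\<close> amounts to the condition on sums below.
\<close>

definition rat_convex_cone :: "(rat ^ 'p) set \<Rightarrow> bool" where
  "rat_convex_cone K \<longleftrightarrow>
     0 \<in> K \<and> (\<forall>x\<in>K. \<forall>y\<in>K. x + y \<in> K) \<and> (\<forall>c x. 0 \<le> c \<longrightarrow> x \<in> K \<longrightarrow> c *s x \<in> K)"

definition cone_face :: "(rat ^ 'p) set \<Rightarrow> (rat ^ 'p) set \<Rightarrow> bool" where
  "cone_face F K \<longleftrightarrow>
     F \<subseteq> K \<and> rat_convex_cone F \<and> (\<forall>x\<in>K. \<forall>y\<in>K. x + y \<in> F \<longrightarrow> x \<in> F \<and> y \<in> F)"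

definition extremal_rays :: "(int ^ 'p) set \<Rightarrow> (int ^ 'p) set set" where
  "extremal_rays S = {nat_points F | F. cone_face F (rat_cone S) \<and> vec.dim F = 1}"

definition ray_mult :: "(int ^ 'p) set \<Rightarrow> (int ^ 'p) set \<Rightarrow> int ^ 'p" where
  "ray_mult S ray = (LEAST x. x \<in> ray \<inter> S \<and> x \<noteq> 0)"

definition apery :: "(int ^ 'p) set \<Rightarrow> int ^ 'p \<Rightarrow> (int ^ 'p) set" where
  "apery S m = {s \<in> S. s - m \<notin> S}"

text \<open>
  The intersection of the Apery sets is taken inside \<open>S\<close>, of which they are all subsets. This
  only matters for \<open>S = {0}\<close>, which has no extremal rays: the empty intersection is then \<open>S\<close>
  and not the whole type.
\<close>

definition med_semigroup :: "(int ^ 'p) set \<Rightarrow> bool" where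
  "med_semigroup S \<longleftrightarrow> affine_semigroup S \<and>
     (\<exists>E A. E \<inter> A = {} \<and> minimally_generates (E \<union> A) S \<and> E = ray_mult S ` extremal_rays S \<and>
            S \<inter> (\<Inter>m\<in>E. apery S m) = A \<union> {0})"

end

(* A submonoid of the nonnegative orthant has no nontrivial units, so its only minimal generating
   set is its set of atoms. Hence the decomposition in the definition of a MED-semigroup is
   the given one. A sum of two atoms is never an atom, so in a MED-semigroup it leaves some Apery
   set. Conversely, if every sum of two elements of A leaves some Apery set, then so does every
   nonzero element of S outside A, since S is generated by E and A. *)

theory Submission
  imports Defs
begin

text \<open>Irreducible elements, with 0 in place of units because 0 is the only unit of a submonoid
  of the orthant.\<close>

definition atoms :: "(int ^ 'p) set \<Rightarrow> (int ^ 'p) set" where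
  "atoms S = {a \<in> S. a \<noteq> 0 \<and> (\<forall>x\<in>S. \<forall>y\<in>S. x + y = a \<longrightarrow> x = 0 \<or> y = 0)}"

lemma add_submonoid_hull: "add_submonoid (add_submonoid hull G)"
  by (rule hull_in) (auto simp: add_submonoid_def)

lemma nat_vecs_add_eq_0:
  assumes "x \<in> nat_vecs" "y \<in> nat_vecs" "x + y = 0"
  shows "x = 0"
proof -
  have "x $ i = 0" for i
  proof -
    have "0 \<le> x $ i" "0 \<le> y $ i"
      using assms(1,2) by (auto simp: nat_vecs_def less_eq_vec_def)
    moreover have "x $ i + y $ i = 0"
      using assms(3) by (metis vector_add_component zero_index)
    ultimately show ?thesis
      by linarith
  qed
  then show ?thesis
    by (simp add: vec_eq_iff)
qed

text \<open>Removing an atom from a monoid leaves a submonoid. If the atom were not in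
  \<open>G\<close>, this smaller submonoid would still contain \<open>G\<close>, hence the whole
  hull.\<close>

lemma atoms_subset_generators: "atoms (add_submonoid hull G) \<subseteq> G"
proof
  let ?S = "add_submonoid hull G"
  fix a
  assume a: "a \<in> atoms ?S"
  have S: "add_submonoid ?S"
    by (rule add_submonoid_hull)
  have "x + y \<in> ?S - {a}" if "x \<in> ?S - {a}" "y \<in> ?S - {a}" for x y
  proof -
    have "x + y \<in> ?S"
      using that S by (simp add: add_submonoid_def)
    moreover have "x + y \<noteq> a"
    proof
      assume "x + y = a"
      then have "x = 0 \<or> y = 0"
        using a that by (simp add: atoms_def)
      then show False
        using \<open>x + y = a\<close> that by auto
    qed
    ultimately show ?thesis
      by simp
  qed
  moreover have "0 \<in> ?S - {a}"
    using a S by (auto simp: atoms_def add_submonoid_def)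
  ultimately have "add_submonoid (?S - {a})"
    by (simp add: add_submonoid_def)
  then have "?S \<subseteq> ?S - {a}" if "a \<notin> G"
    using that by (intro hull_minimal) (auto intro: hull_inc)
  then show "a \<in> G"
    using a by (auto simp: atoms_def)
qed

text \<open>A representation of \<open>s\<close> as a sum of generators either avoids
  \<open>g\<close>, or contains a copy of \<open>g\<close> that can be cancelled.\<close>

lemma hull_remove_generator:
  assumes "s \<in> add_submonoid hull G"
  shows "s \<in> add_submonoid hull (G - {g}) \<or> s - g \<in> add_submonoid hull G"
proof -
  let ?S = "add_submonoid hull G" and ?H = "add_submonoid hull (G - {g})"
  have S: "add_submonoid ?S" and H: "add_submonoid ?H"
    by (rule add_submonoid_hull)+
  have HS: "?H \<subseteq> ?S"
    by (rule hull_mono) auto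
  \<comment> \<open>Membership in \<open>?S\<close> is carried along because cancelling
    \<open>g\<close> from one summand of \<open>x + y\<close> leaves the other summand to be added
    back inside \<open>?S\<close>.\<close>
  let ?P = "\<lambda>s. s \<in> ?S \<and> (s \<in> ?H \<or> s - g \<in> ?S)"
  have "?P s"
    using assms
  proof (rule hull_induct)
    fix x
    assume "x \<in> G"
    then show "?P x"
      using S by (cases "x = g") (auto intro: hull_inc simp: add_submonoid_def)
  next
    have "?P (x + y)" if "?P x" "?P y" for x y
    proof -
      have "(x - g) + y \<in> ?S" if "x - g \<in> ?S"
        using that \<open>?P y\<close> S unfolding add_submonoid_def by blast
      moreover have "x + (y - g) \<in> ?S" if "y - g \<in> ?S"
        using that \<open>?P x\<close> S unfolding add_submonoid_def by blast
      moreover have "x + y \<in> ?H" if "x \<in> ?H" "y \<in> ?H"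
        using that H unfolding add_submonoid_def by blast
      moreover have "x + y \<in> ?S"
        using \<open>?P x\<close> \<open>?P y\<close> S unfolding add_submonoid_def by blast
      ultimately show ?thesis
        using \<open>?P x\<close> \<open>?P y\<close> unfolding add_diff_eq diff_add_eq by blast
    qed
    moreover have "?P 0"
      using S H by (auto simp: add_submonoid_def)
    ultimately show "add_submonoid {s. ?P s}"
      by (simp add: add_submonoid_def)
  qed
  then show ?thesis
    by blast
qed

text \<open>By minimality no generator \<open>g\<close> lies in the hull of the others. So in a
  splitting \<open>g = x + y\<close>, at least one summand must involve \<open>g\<close>, and
  positivity then kills the other one.\<close>

lemma minimal_generators_eq_atoms:
  assumes "minimally_generates G S" and nonneg: "S \<subseteq> nat_vecs"
  shows "G = atoms S"
proof
  have S: "S = add_submonoid hull G" and min: "\<And>H. H \<subset> G \<Longrightarrow> add_submonoid hull H \<noteq> S"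
    using assms by (auto simp: minimally_generates_def)
  show "atoms S \<subseteq> G"
    unfolding S by (rule atoms_subset_generators)
  show "G \<subseteq> atoms S"
  proof
    fix g
    assume g: "g \<in> G"
    let ?H = "add_submonoid hull (G - {g})"
    have H: "add_submonoid ?H"
      by (rule add_submonoid_hull)
    have gH: "g \<notin> ?H"
    proof
      assume "g \<in> ?H"
      then have "G \<subseteq> ?H"
        by (auto intro: hull_inc)
      then have "S \<subseteq> ?H"
        unfolding S using H by (rule hull_minimal)
      moreover have "?H \<subseteq> S"
        unfolding S by (rule hull_mono) auto
      ultimately show False
        using min[of "G - {g}"] g by blast
    qed
    have "x = 0 \<or> y = 0" if xy: "x \<in> S" "y \<in> S" "x + y = g" for x y
    proof -
      \<comment> \<open>If \<open>x - g\<close> is in \<open>S\<close>, it and \<open>y\<close> are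
        two vectors of the orthant with sum 0, so \<open>y\<close> vanishes; likewise with the roles
        exchanged.\<close>
      have "y + (x - g) = 0" "x + (y - g) = 0"
        using xy(3) by auto
      then have "x - g \<in> S \<Longrightarrow> y = 0" "y - g \<in> S \<Longrightarrow> x = 0"
        using nat_vecs_add_eq_0 xy(1,2) nonneg by blast+
      moreover have "x \<notin> ?H \<or> y \<notin> ?H"
        using gH H xy(3) by (auto simp: add_submonoid_def)
      ultimately show ?thesis
        using hull_remove_generator[of x G g] hull_remove_generator[of y G g] xy S by blast
    qed
    moreover have "g \<noteq> 0"
      using gH H by (auto simp: add_submonoid_def)
    moreover have "g \<in> S"
      unfolding S using g by (rule hull_inc)
    ultimately show "g \<in> atoms S"
      by (auto simp: atoms_def)
  qed
qed

lemma atoms_add_notin: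
  assumes "a \<in> atoms S" "b \<in> atoms S"
  shows "a + b \<notin> atoms S"
  using assms by (auto simp: atoms_def)

lemma atom_in_apery:
  assumes "S \<subseteq> nat_vecs" "m \<in> atoms S" "a \<in> atoms S" "a \<noteq> m"
  shows "a \<in> apery S m"
proof -
  have "m + (a - m) = a"
    by simp
  then have "a - m \<notin> S"
    using assms(2-4) unfolding atoms_def by force
  then show ?thesis
    using assms(3) by (simp add: apery_def atoms_def)
qed

text \<open>Otherwise \<open>m\<close> would have its negative in \<open>S\<close>, which positivity
  allows only for 0.\<close>

lemma zero_in_apery:
  assumes "S \<subseteq> nat_vecs" "0 \<in> S" "m \<in> atoms S"
  shows "0 \<in> apery S m"
proof -
  have "0 - m \<notin> S"
    using nat_vecs_add_eq_0[of m "0 - m"] assms by (auto simp: atoms_def)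
  then show ?thesis
    using assms(2) by (simp add: apery_def)
qed

lemma Inter_apery_subset:
  assumes S: "add_submonoid hull (E \<union> A) = S"
    and add: "\<And>a b. a \<in> A \<Longrightarrow> b \<in> A \<Longrightarrow> \<exists>m\<in>E. a + b - m \<in> S"
  shows "S \<inter> (\<Inter>m\<in>E. apery S m) \<subseteq> A \<union> {0}"
proof -
  have sub: "add_submonoid S"
    unfolding S[symmetric] by (rule add_submonoid_hull)
  \<comment> \<open>The last alternative says that \<open>s\<close> lies outside some Apery set. It
    persists when any element of \<open>S\<close> is added, which makes the property
    inductive.\<close>
  let ?P = "\<lambda>s. s \<in> S \<and> (s = 0 \<or> s \<in> A \<or> (\<exists>m\<in>E. s - m \<in> S))"
  have P: "?P s" if "s \<in> S" for s
    using that unfolding S[symmetric]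
  proof (rule hull_induct, unfold S)
    fix x
    assume x: "x \<in> E \<union> A"
    then have "x \<in> S"
      unfolding S[symmetric] by (rule hull_inc)
    \<comment> \<open>For a generator \<open>x\<close> in \<open>E\<close> the witness is
      \<open>m = x\<close>.\<close>
    moreover have "x - x \<in> S"
      using sub by (simp add: add_submonoid_def)
    ultimately show "?P x"
      using x by blast
  next
    have "?P (x + y)" if x: "?P x" and y: "?P y" for x y
    proof -
      have "(x - m) + y \<in> S" if "x - m \<in> S" for m
        using that y sub unfolding add_submonoid_def by blast
      moreover have "x + (y - m) \<in> S" if "y - m \<in> S" for m
        using that x sub unfolding add_submonoid_def by blast
      ultimately have "\<exists>m\<in>E. x + y - m \<in> S" if "\<exists>m\<in>E. x - m \<in> S \<or> y - m \<in> S"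
        using that unfolding add_diff_eq diff_add_eq by blast
      moreover have "x + y \<in> S"
        using x y sub by (simp add: add_submonoid_def)
      ultimately show ?thesis
        \<comment> \<open>A zero summand changes nothing. If both are nonzero, either some
          \<open>m\<close> in \<open>E\<close> can be subtracted from one of them, or both lie in
          \<open>A\<close>, where the hypothesis \<open>add\<close> applies.\<close>
        using x y add[of x y] by (cases "x = 0"; cases "y = 0") (simp, simp, simp, blast)
    qed
    moreover have "?P 0"
      using sub by (simp add: add_submonoid_def)
    ultimately show "add_submonoid {s. ?P s}"
      by (simp add: add_submonoid_def)
  qed
  show ?thesis
  proof
    fix s
    assume "s \<in> S \<inter> (\<Inter>m\<in>E. apery S m)"
    then show "s \<in> A \<union> {0}"
      using P[of s] by (auto simp: apery_def)
  qed
qed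

theorem proposition19:
  fixes S :: "(int ^ 'p) set"
    and \<tau> :: "nat \<Rightarrow> (int ^ 'p) set"
    and n :: "nat \<Rightarrow> int ^ 'p"
    and t r :: nat
  assumes "affine_semigroup S"
    and "bij_betw \<tau> {1..t} (extremal_rays S)"
    and "t \<le> r"
    and "inj_on n {1..r}"
    and "minimally_generates (n ` {1..r}) S"
    and "\<forall>i\<in>{1..t}. n i = ray_mult S (\<tau> i)"
  shows "med_semigroup S \<longleftrightarrow>
    (\<forall>i\<in>{t+1..r}. \<forall>j\<in>{t+1..r}. \<exists>k\<in>{1..t}. n i + n j - n k \<in> S)"
proof -
  define E where "E = n ` {1..t}"
  define A where "A = n ` {t+1..r}"
  have nonneg: "S \<subseteq> nat_vecs"
    using assms(1) by (simp add: affine_semigroup_def)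
  have S: "add_submonoid S"
    using assms(5) add_submonoid_hull by (auto simp: minimally_generates_def)
  have "{1..r} = {1..t} \<union> {t+1..r}"
    using assms(3) by auto
  then have EA: "n ` {1..r} = E \<union> A"
    by (simp add: E_def A_def image_Un)
  have gen: "minimally_generates (E \<union> A) S"
    using assms(5) unfolding EA .
  have atoms: "E \<union> A = atoms S"
    using gen nonneg by (rule minimal_generators_eq_atoms)
  have disj: "E \<inter> A = {}"
    unfolding E_def A_def
    using inj_on_image_Int[OF assms(4), of "{1..t}" "{t+1..r}"] assms(3) by auto
  \<comment> \<open>The set of multiplicities does not depend on how the rays are indexed, so
    \<open>E\<close> is exactly the set prescribed by \<open>med_semigroup\<close> and only the
    other block of generators is left to identify.\<close>
  have "E = ray_mult S ` \<tau> ` {1..t}"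
    using assms(6) by (auto simp: E_def image_image)
  then have E: "E = ray_mult S ` extremal_rays S"
    using assms(2) by (simp add: bij_betw_def)
  have "med_semigroup S \<longleftrightarrow> (\<forall>a\<in>A. \<forall>b\<in>A. \<exists>m\<in>E. a + b - m \<in> S)"
  proof
    assume "med_semigroup S"
    then obtain A' where A': "E \<inter> A' = {}" "minimally_generates (E \<union> A') S"
        "S \<inter> (\<Inter>m\<in>E. apery S m) = A' \<union> {0}"
      unfolding med_semigroup_def E by blast
    have "E \<union> A' = atoms S"
      using A'(2) nonneg by (rule minimal_generators_eq_atoms)
    then have "A' = A"
      using atoms disj A'(1) by blast
    with A'(3) have apery: "S \<inter> (\<Inter>m\<in>E. apery S m) = A \<union> {0}"
      by simp
    show "\<forall>a\<in>A. \<forall>b\<in>A. \<exists>m\<in>E. a + b - m \<in> S"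
    proof (intro ballI)
      fix a b
      assume ab: "a \<in> A" "b \<in> A"
      then have at: "a \<in> atoms S" "b \<in> atoms S"
        using atoms by auto
      have "a \<in> S" "b \<in> S" "a \<noteq> 0"
        using at by (auto simp: atoms_def)
      then have "a + b \<noteq> 0" "a + b \<in> S"
        using nat_vecs_add_eq_0[of a b] nonneg S by (auto simp: add_submonoid_def)
      moreover have "a + b \<notin> A"
        using atoms_add_notin[OF at] atoms by auto
      \<comment> \<open>Lying in \<open>S\<close> but not in \<open>A \<union> {0}\<close>, the sum
        misses some Apery set; for an element of \<open>S\<close> this means that the difference
        with \<open>m\<close> is in \<open>S\<close>.\<close>
      ultimately show "\<exists>m\<in>E. a + b - m \<in> S"
        using apery by (auto simp: apery_def)
    qed
  next
    assume add: "\<forall>a\<in>A. \<forall>b\<in>A. \<exists>m\<in>E. a + b - m \<in> S"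
    have "S \<inter> (\<Inter>m\<in>E. apery S m) \<subseteq> A \<union> {0}"
      using gen add by (intro Inter_apery_subset) (auto simp: minimally_generates_def)
    moreover have "A \<union> {0} \<subseteq> apery S m" if "m \<in> E" for m
      using that atoms disj S nonneg
      by (auto intro!: atom_in_apery zero_in_apery simp: add_submonoid_def)
    \<comment> \<open>For empty \<open>E\<close> the preceding inclusion is vacuous, so containment
      in \<open>S\<close> is established separately.\<close>
    moreover have "A \<union> {0} \<subseteq> S"
      using atoms S by (auto simp: atoms_def add_submonoid_def)
    ultimately have "S \<inter> (\<Inter>m\<in>E. apery S m) = A \<union> {0}"
      by blast
    then show "med_semigroup S"
      using assms(1) disj gen E unfolding med_semigroup_def by blast
  qed
  then show ?thesis
    by (simp add: E_def A_def)
qed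

end
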